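(* Let $\phi$ be a CNF formula, let $\{X,Y\}$ be a partition of $\mathrm{vars}(\phi)$, let $(T,r,\gamma,\pi)$ be an $(X,Y)$-graded project-join tree for $\phi$ with grades $\mathcal{I}_X,\mathcal{I}_Y$, and let $\mathrm{pr}:Y\to[0,1]$ be a probability mapping. Then the $\mathrm{pr}$-valuation of the root satisfies $$\mathrm{val}(r)(\emptyset)=\big(\exists_X\,\mathcal{R}^{\mathrm{pr}}_Y\,[\phi]\big)(\emptyset).$$
   Context: Variables are binary and $\mathbb{B}=\{0,1\}$. $2^S$ is the set of truth assignments $S\to\mathbb{B}$. A pseudo-Boolean (PB) function over $X$ is a map $f:2^X\to\mathbb{R}$. Join: $(f\cdot g)(\tau)=f(\tau|_X)\,g(\tau|_Y)$ for $f$ over $X$, $g$ over $Y$, and $\tau\in 2^{X\cup Y}$. Existential projection: $(\exists_x f)(\tau)=\max(f(\tau\cup\{x\mapsto0\}),f(\tau\cup\{x\mapsto1\}))$. Random projection: $(\mathcal{R}^p_x f)(\tau)=p f(\tau\cup\{x\mapsto1\})+(1-p)f(\tau\cup\{x\mapsto0\})$. For a set $S$, $\exists_S$ and $\mathcal{R}^{\mathrm{pr}}_S$ apply these operations for every $x\in S$, using probability $\mathrm{pr}(x)$ for $\mathcal{R}$. Both are order-independent and are the identity when $S=\emptyset$. A CNF formula $\phi$ is a set of clauses; $[\psi]$ is the 0/1-valued function of a formula $\psi$, and $[\phi]=\prod_{c\in\phi}[c]$. In a rooted tree $(T,r)$, $C(v)$ denotes the children of $v$. Leaves are non-root nodes of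 degree one; the other nodes are internal. A project-join tree for $\phi$ is $(T,r,\gamma,\pi)$ where: - $\gamma$ is a bijection from the leaves to the clauses of $\phi$; - $\pi$ maps internal nodes to subsets of $\mathrm{vars}(\phi)$; - $\{\pi(v)\}$ partitions $\mathrm{vars}(\phi)$, where some $\pi(v)$ may be empty; - for internal $v$, $x\in\pi(v)$ and a clause $c$ containing $x$, the leaf $\gamma^{-1}(c)$ is a descendant of $v$. It is $(X,Y)$-graded with grades $\mathcal{I}_X,\mathcal{I}_Y$ if: - $\{\mathcal{I}_X,\mathcal{I}_Y\}$ partitions the internal nodes; - $\pi(v)\subseteq X$ for $v\in\mathcal{I}_X$; - $\pi(v)\subseteq Y$ for $v\in\mathcal{I}_Y$; - no node of $\mathcal{I}_X$ is a descendant of a node of $\mathcal{I}_Y$. The $\mathrm{pr}$-valuation of a node $v$ is defined recursively: - $\mathrm{val}(v)=[\gamma(v)]$ if $v$ is a leaf; - $\mathrm{val}(v)=\exists_{\pi(v)}\prod_{v'\in C(v)}\mathrm{val}(v')$ if $v\in\mathcal{I}_X$; - $\mathrm{val}(v)=\mathcal{R}^{\mathrm{pr}}_{\pi(v)}\prod_{v'\in C(v)}\mathrm{val}(v')$ if $v\in\mathcal{I}_Y$. *)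

theory Defs
  imports Complex_Main "HOL-Library.Disjoint_Sets" "Graph_Theory.Graph_Theory"
begin

section \<open>Pseudo-Boolean functions\<close>

text \<open>
  A truth assignment of a set \<open>S\<close> of variables is a partial map with domain \<open>S\<close>. A PB function
  over \<open>S\<close> carries its scope \<open>S\<close>; only its values on assignments with domain exactly \<open>S\<close> are
  meaningful, the others are junk.
\<close>

type_synonym 'v assignment = "'v \<rightharpoonup> bool"

datatype 'v pb = PB (pb_scope: "'v set") (pb_eval: "'v assignment \<Rightarrow> real")

definition pb_join :: "'v pb \<Rightarrow> 'v pb \<Rightarrow> 'v pb" where
  "pb_join f g = PB (pb_scope f \<union> pb_scope g)
     (\<lambda>\<tau>. pb_eval f (\<tau> |` pb_scope f) * pb_eval g (\<tau> |` pb_scope g))"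

definition pb_one :: "'v pb" where
  "pb_one = PB {} (\<lambda>_. 1)"

definition pb_Join :: "('i \<Rightarrow> 'v pb) \<Rightarrow> 'i set \<Rightarrow> 'v pb" where
  "pb_Join F I = Finite_Set.fold (\<lambda>i. pb_join (F i)) pb_one I"

definition exist_proj :: "'v \<Rightarrow> 'v pb \<Rightarrow> 'v pb" where
  "exist_proj x f = PB (pb_scope f - {x})
     (\<lambda>\<tau>. max (pb_eval f (\<tau>(x \<mapsto> False))) (pb_eval f (\<tau>(x \<mapsto> True))))"

definition random_proj :: "real \<Rightarrow> 'v \<Rightarrow> 'v pb \<Rightarrow> 'v pb" where
  "random_proj p x f = PB (pb_scope f - {x})
     (\<lambda>\<tau>. p * pb_eval f (\<tau>(x \<mapsto> True)) + (1 - p) * pb_eval f (\<tau>(x \<mapsto> False)))"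

definition exist_proj_set :: "'v set \<Rightarrow> 'v pb \<Rightarrow> 'v pb" where
  "exist_proj_set S f = Finite_Set.fold exist_proj f S"

definition random_proj_set :: "('v \<Rightarrow> real) \<Rightarrow> 'v set \<Rightarrow> 'v pb \<Rightarrow> 'v pb" where
  "random_proj_set pr S f = Finite_Set.fold (\<lambda>x. random_proj (pr x) x) f S"

text \<open>
  \<open>Finite_Set.fold\<close> is only well-behaved for commuting steps; the following three facts establish
  this, that is, the order-independence of products and projections.
\<close>

lemma comp_fun_commute_pb_join: "comp_fun_commute (\<lambda>i. pb_join (F i))"
  by standard (auto simp: pb_join_def fun_eq_iff Int_commute Int_Un_distrib Int_absorb1)

lemma comp_fun_commute_exist_proj: "comp_fun_commute exist_proj"
proof
  fix x y :: 'v
  show "exist_proj y \<circ> exist_proj x = exist_proj x \<circ> exist_proj y"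
    by (cases "x = y")
      (auto simp: exist_proj_def fun_eq_iff fun_upd_twist max.left_commute max.assoc)
qed

lemma comp_fun_commute_random_proj:
  fixes pr :: "'v \<Rightarrow> real"
  shows "comp_fun_commute (\<lambda>x. random_proj (pr x) x)"
proof
  fix x y :: 'v
  show "random_proj (pr y) y \<circ> random_proj (pr x) x = random_proj (pr x) x \<circ> random_proj (pr y) y"
    by (cases "x = y")
      (auto simp: random_proj_def fun_eq_iff fun_upd_twist algebra_simps)
qed

lemma pb_Join_empty [simp]: "pb_Join F {} = pb_one"
  by (simp add: pb_Join_def)

lemma pb_Join_insert [simp]:
  "finite I \<Longrightarrow> i \<notin> I \<Longrightarrow> pb_Join F (insert i I) = pb_join (F i) (pb_Join F I)"
  unfolding pb_Join_def by (rule comp_fun_commute_on.fold_insert[where S = UNIV])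
    (use comp_fun_commute_pb_join in \<open>auto simp: comp_fun_commute_def'\<close>)

lemma exist_proj_set_empty [simp]: "exist_proj_set {} f = f"
  by (simp add: exist_proj_set_def)

lemma exist_proj_set_insert [simp]:
  "finite S \<Longrightarrow> x \<notin> S \<Longrightarrow> exist_proj_set (insert x S) f = exist_proj x (exist_proj_set S f)"
  unfolding exist_proj_set_def
  by (rule comp_fun_commute_on.fold_insert[where S = UNIV])
    (use comp_fun_commute_exist_proj in \<open>auto simp: comp_fun_commute_def'\<close>)

lemma random_proj_set_empty [simp]: "random_proj_set pr {} f = f"
  by (simp add: random_proj_set_def)

lemma random_proj_set_insert [simp]:
  "finite S \<Longrightarrow> x \<notin> S \<Longrightarrow>
    random_proj_set pr (insert x S) f = random_proj (pr x) x (random_proj_set pr S f)"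
  unfolding random_proj_set_def
  by (rule comp_fun_commute_on.fold_insert[where S = UNIV])
    (use comp_fun_commute_random_proj in \<open>auto simp: comp_fun_commute_def'\<close>)

lemma pb_Join_cong [fundef_cong]:
  assumes "I = J" "\<And>i. i \<in> J \<Longrightarrow> F i = G i"
  shows "pb_Join F I = pb_Join G J"
proof (cases "finite J")
  case True
  then have "pb_Join F J = pb_Join G J"
    using assms(2) by (induction J rule: finite_induct) auto
  with assms(1) show ?thesis by simp
next
  case False
  with assms(1) show ?thesis by (simp add: pb_Join_def)
qed

section \<open>CNF formulas\<close>

datatype 'v lit = Pos (lit_var: 'v) | Neg (lit_var: 'v)

type_synonym 'v clause = "'v lit set"
type_synonym 'v cnf = "'v clause set"

definition is_cnf :: "'v cnf \<Rightarrow> bool" where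
  "is_cnf \<phi> \<longleftrightarrow> finite \<phi> \<and> (\<forall>c\<in>\<phi>. finite c)"

definition clause_vars :: "'v clause \<Rightarrow> 'v set" where
  "clause_vars c = lit_var ` c"

definition cnf_vars :: "'v cnf \<Rightarrow> 'v set" where
  "cnf_vars \<phi> = (\<Union>c\<in>\<phi>. clause_vars c)"

fun lit_sat :: "'v assignment \<Rightarrow> 'v lit \<Rightarrow> bool" where
  "lit_sat \<tau> (Pos x) \<longleftrightarrow> \<tau> x = Some True"
| "lit_sat \<tau> (Neg x) \<longleftrightarrow> \<tau> x = Some False"

definition clause_sat :: "'v assignment \<Rightarrow> 'v clause \<Rightarrow> bool" where
  "clause_sat \<tau> c \<longleftrightarrow> (\<exists>l\<in>c. lit_sat \<tau> l)"

definition clause_pb :: "'v clause \<Rightarrow> 'v pb" where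
  "clause_pb c = PB (clause_vars c) (\<lambda>\<tau>. of_bool (clause_sat \<tau> c))"

definition cnf_pb :: "'v cnf \<Rightarrow> 'v pb" where
  "cnf_pb \<phi> = pb_Join clause_pb \<phi>"

lemma lit_sat_restrict: "lit_var l \<in> S \<Longrightarrow> lit_sat (\<tau> |` S) l \<longleftrightarrow> lit_sat \<tau> l"
  by (cases l) auto

lemma clause_sat_restrict: "clause_vars c \<subseteq> S \<Longrightarrow> clause_sat (\<tau> |` S) c \<longleftrightarrow> clause_sat \<tau> c"
  unfolding clause_sat_def clause_vars_def
  by (intro bex_cong refl lit_sat_restrict) auto

lemma pb_scope_cnf_pb: "finite \<phi> \<Longrightarrow> pb_scope (cnf_pb \<phi>) = cnf_vars \<phi>"
  unfolding cnf_pb_def cnf_vars_def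
  by (induction \<phi> rule: finite_induct) (auto simp: pb_one_def pb_join_def clause_pb_def)

lemma pb_eval_cnf_pb:
  assumes "finite \<phi>"
  shows "pb_eval (cnf_pb \<phi>) \<tau> = of_bool (\<forall>c\<in>\<phi>. clause_sat \<tau> c)"
  using assms
proof (induction \<phi> arbitrary: \<tau> rule: finite_induct)
  case empty
  show ?case by (simp add: cnf_pb_def pb_one_def)
next
  case (insert c \<phi>)
  have "\<forall>d\<in>\<phi>. clause_sat (\<tau> |` cnf_vars \<phi>) d \<longleftrightarrow> clause_sat \<tau> d"
    by (auto simp: cnf_vars_def intro!: clause_sat_restrict)
  moreover have "cnf_pb (insert c \<phi>) = pb_join (clause_pb c) (cnf_pb \<phi>)"
    using insert by (simp add: cnf_pb_def)
  moreover have "pb_scope (cnf_pb \<phi>) = cnf_vars \<phi>"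
    using insert by (simp add: pb_scope_cnf_pb)
  ultimately show ?case
    using insert by (simp add: pb_join_def clause_pb_def clause_sat_restrict)
qed

section \<open>Rooted trees\<close>

text \<open>
  In the graph library a finite simple undirected graph is a symmetric digraph without loops and
  parallel arcs (locale \<open>graph\<close>), every edge being a pair of opposite arcs. There the walk
  \<open>a, b, a\<close> counts as a cycle, so the library's predicate \<open>tree\<close> fails for every such graph with
  an edge. Cycles of the undirected graph are the cycles with at least three arcs.
\<close>

locale rooted_tree = graph T for T :: "('n, 'e) pre_digraph" (structure) +
  fixes r :: 'n
  assumes root_in_verts: "r \<in> verts T"
    and connected: "connected T"
    and acyclic: "\<And>p. cycle p \<Longrightarrow> length p < 3"
begin

text \<open>\<open>descendant v w\<close>: \<open>w\<close> is a (not necessarily proper) descendant of \<open>v\<close>.\<close>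

definition descendant :: "'n \<Rightarrow> 'n \<Rightarrow> bool" where
  "descendant v w \<longleftrightarrow> (\<exists>p. apath r p w \<and> v \<in> set (awalk_verts r p))"

definition children :: "'n \<Rightarrow> 'n set" where
  "children v = {w. v \<rightarrow> w \<and> descendant v w}"

definition leaves :: "'n set" where
  "leaves = {v \<in> verts T. v \<noteq> r \<and> out_degree T v = 1}"

definition internal :: "'n set" where
  "internal = verts T - leaves"

lemma apath_last_in_verts: "apath u p v \<Longrightarrow> v \<in> set (awalk_verts u p)"
  unfolding apath_def awalk_conv using last_in_set[OF awalk_verts_non_Nil, of u p] by simp

lemma apath_unique:
  assumes "apath u p v" "apath u q v"
  shows "p = q"
  using assms
proof (induction p arbitrary: u q)
  case Nil
  then have uv: "u = v" by (simp add: apath_def awalk_def)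
  show ?case
  proof (cases q)
    case (Cons f q')
    with Nil.prems(2) have "apath (head T f) q' v" "u \<notin> set (awalk_verts (head T f) q')"
      by (auto simp: apath_Cons_iff)
    then have "u \<noteq> v" using apath_last_in_verts by blast
    with uv show ?thesis by simp
  qed simp
next
  case (Cons e p')
  have e: "e \<in> arcs T" "tail T e = u" and p': "apath (head T e) p' v"
    and up': "u \<notin> set (awalk_verts (head T e) p')"
    using Cons.prems(1) by (auto simp: apath_Cons_iff)
  show ?case
  proof (cases q)
    case Nil
    with Cons.prems(2) have "u = v" by (simp add: apath_def awalk_def)
    with p' up' show ?thesis using apath_last_in_verts by blast
  next
    case q: (Cons f q')
    have f: "f \<in> arcs T" "tail T f = u" and q': "apath (head T f) q' v"
      and uq': "u \<notin> set (awalk_verts (head T f) q')"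
      using Cons.prems(2) q by (auto simp: apath_Cons_iff)
    show ?thesis
    proof (cases "head T e = head T f")
      case True
      with e f have "e = f" by (intro no_multi_arcs) (auto simp: arc_to_ends_def)
      with Cons.IH[OF p', of q'] q' q show ?thesis by simp
    next
      case False
      define D where "D = del_vert u"
      interpret D: wf_digraph D unfolding D_def by (rule wf_digraph_del_vert)
      have sub: "subgraph D T" unfolding D_def by (rule subgraph_del_vert)
      have symT: "symmetric T" by (rule sym_arcs)
      have symD: "symmetric D"
        using symT unfolding symmetric_conv D_def
        by (auto simp: arcs_del_vert tail_del_vert head_del_vert)
      have reach: "a \<rightarrow>\<^sup>*\<^bsub>D\<^esub> v" if "apath a s v" "u \<notin> set (awalk_verts a s)" for a s
      proof -
        have "D.awalk a s v"
          using that
        proof (induction s arbitrary: a)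
          case Nil
          then have "a = v" "v \<in> verts D"
            by (auto simp: apath_def awalk_def D_def verts_del_vert)
          then show ?case by (simp add: D.awalk_Nil_iff)
        next
          case (Cons g s)
          then have "D.awalk (head T g) s v" "g \<in> arcs T" "tail T g = a" "a \<noteq> u"
            by (auto simp: apath_Cons_iff)
          moreover have "head T g \<noteq> u"
            using Cons.prems by (cases s) (auto simp: apath_Cons_iff)
          moreover have "arcs D = {a \<in> arcs T. tail T a \<noteq> u \<and> head T a \<noteq> u}"
            "tail D = tail T" "head D = head T"
            by (simp_all add: D_def arcs_del_vert tail_del_vert head_del_vert)
          ultimately show ?case by (simp add: D.awalk_Cons_iff)
        qed
        then show ?thesis by (auto simp: D.reachable_awalk)
      qed
      have "head T e \<rightarrow>\<^sup>*\<^bsub>D\<^esub> v" by (rule reach[OF p' up'])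
      moreover have "v \<rightarrow>\<^sup>*\<^bsub>D\<^esub> head T f"
        by (rule symmetric_reachable[OF symD reach[OF q' uq']])
      ultimately have "head T e \<rightarrow>\<^sup>*\<^bsub>D\<^esub> head T f" by (rule D.reachable_trans)
      then obtain s where s: "D.apath (head T e) s (head T f)"
        by (auto simp: D.reachable_apath)
      then have aw: "awalk (head T e) s (head T f)"
        using sub by (auto simp: D.apath_def intro: subgraph_awalk_imp_awalk)
      have eqv: "D.awalk_verts a t = awalk_verts a t" for a t
      proof -
        have "tail D = tail T" "head D = head T"
          by (simp_all add: D_def tail_del_vert head_del_vert)
        then show ?thesis by (induction t arbitrary: a) simp_all
      qed
      have dist: "distinct (awalk_verts (head T e) s)" using s by (simp add: D.apath_def eqv)
      have nu: "u \<notin> set (awalk_verts (head T e) s)"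
      proof -
        have "set (D.awalk_verts (head T e) s) \<subseteq> verts D"
          using s unfolding D.apath_def D.awalk_conv by simp
        moreover have "u \<notin> verts D" by (simp add: D_def verts_del_vert)
        ultimately show ?thesis by (auto simp: eqv)
      qed
      obtain g where g: "g \<in> arcs T" "tail T g = head T f" "head T g = u"
        using symT f unfolding symmetric_conv by metis
      have "awalk u (e # s @ [g]) u"
        using aw e g by (auto simp: awalk_Cons_iff awalk_simps awalk_append_iff)
      moreover have "awalk_verts (head T e) (s @ [g]) = awalk_verts (head T e) s @ [u]"
        using aw g by (subst awalk_verts_append) (auto simp: awalk_simps awalk_append_iff)
      then have "distinct (tl (awalk_verts u (e # s @ [g])))"
        using dist nu by simp
      ultimately have "cycle (e # s @ [g])" unfolding cycle_def by blast
      then have "length (e # s @ [g]) < 3" by (rule acyclic)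
      then have "s = []" by simp
      with aw False show ?thesis by (simp add: awalk_def)
    qed
  qed
qed

definition depth :: "'n \<Rightarrow> nat" where
  "depth v = length (THE p. apath r p v)"

lemma depth_eq: "apath r p v \<Longrightarrow> depth v = length p"
  unfolding depth_def by (metis (mono_tags, lifting) apath_unique the_equality)

lemma depth_less: "apath r p v \<Longrightarrow> depth v < card (verts T)"
proof -
  assume p: "apath r p v"
  then have "distinct (awalk_verts r p)" "set (awalk_verts r p) \<subseteq> verts T"
    by (auto simp: apath_def elim!: awalkE)
  then have "length (awalk_verts r p) \<le> card (verts T)"
    by (metis card_mono distinct_card finite_verts)
  with p show ?thesis by (simp add: depth_eq length_awalk_verts)
qed

lemma depth_children:
  assumes "w \<in> children v"
  shows "depth v < depth w" "depth w < card (verts T)"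
proof -
  from assms obtain p where p: "apath r p w" "v \<in> set (awalk_verts r p)" and vw: "v \<rightarrow> w"
    by (auto simp: children_def descendant_def)
  from vw have "v \<noteq> w" using adj_not_same by blast
  from p have "awalk r p w" by (simp add: apath_def)
  then obtain q s where qs: "p = q @ s" "awalk r q v" "awalk v s w"
    using awalk_decomp p(2) by blast
  with \<open>v \<noteq> w\<close> have "s \<noteq> []" by (auto simp: awalk_def)
  moreover have "apath r q v"
    using p(1) qs unfolding qs(1) apath_append_iff awalk_conv by simp
  ultimately show "depth v < depth w" using p(1) qs by (simp add: depth_eq)
  show "depth w < card (verts T)" using p(1) by (rule depth_less)
qed

lemma card_depth_less: "w \<in> children v \<Longrightarrow> card (verts T) - depth w < card (verts T) - depth v"
  using depth_children[of w v] by linarith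

end

section \<open>Graded project-join trees\<close>

locale project_join_tree = rooted_tree T r
  for T :: "('n, 'e) pre_digraph" (structure) and r :: 'n +
  fixes \<gamma> :: "'n \<Rightarrow> 'v clause" and \<pi> :: "'n \<Rightarrow> 'v set" and \<phi> :: "'v cnf"
  assumes gamma_bij: "bij_betw \<gamma> leaves \<phi>"
    and pi_disjoint: "disjoint_family_on \<pi> internal"
    and pi_Union: "(\<Union>v\<in>internal. \<pi> v) = cnf_vars \<phi>"
    and pi_descendant: "\<And>v x c. v \<in> internal \<Longrightarrow> x \<in> \<pi> v \<Longrightarrow> c \<in> \<phi> \<Longrightarrow> x \<in> clause_vars c \<Longrightarrow>
      descendant v (the_inv_into leaves \<gamma> c)"

locale graded_project_join_tree = project_join_tree T r \<gamma> \<pi> \<phi>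
  for T :: "('n, 'e) pre_digraph" (structure) and r :: 'n
    and \<gamma> :: "'n \<Rightarrow> 'v clause" and \<pi> :: "'n \<Rightarrow> 'v set" and \<phi> :: "'v cnf" +
  fixes X Y :: "'v set" and I\<^sub>X I\<^sub>Y :: "'n set"
  assumes grades_Un: "I\<^sub>X \<union> I\<^sub>Y = internal"
    and grades_Int: "I\<^sub>X \<inter> I\<^sub>Y = {}"
    and pi_X: "\<And>v. v \<in> I\<^sub>X \<Longrightarrow> \<pi> v \<subseteq> X"
    and pi_Y: "\<And>v. v \<in> I\<^sub>Y \<Longrightarrow> \<pi> v \<subseteq> Y"
    and grades_descendant: "\<And>u v. u \<in> I\<^sub>Y \<Longrightarrow> v \<in> I\<^sub>X \<Longrightarrow> \<not> descendant u v"
begin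

text \<open>The last branch only concerns points outside the tree.\<close>

function valuation :: "('v \<Rightarrow> real) \<Rightarrow> 'n \<Rightarrow> 'v pb" where
  "valuation pr v =
    (if v \<in> leaves then clause_pb (\<gamma> v)
     else if v \<in> I\<^sub>X then exist_proj_set (\<pi> v) (pb_Join (valuation pr) (children v))
     else if v \<in> I\<^sub>Y then random_proj_set pr (\<pi> v) (pb_Join (valuation pr) (children v))
     else undefined)"
  by auto
termination
  by (relation "measure (\<lambda>(pr, v). card (verts T) - depth v)")
    (simp_all add: card_depth_less)

declare valuation.simps [simp del]

end

end

theory Submission
  imports Defs
begin

text \<open>
  Induction along the tree: the valuation of a node \<open>v\<close> is
  \<open>\<exists>\<^bsub>A\<^esub> \<R>\<^bsub>B\<^esub> \<Prod>[\<gamma> l]\<close>, the product ranging over the leaves \<open>l\<close> below \<open>v\<close>, and \<open>A\<close>, \<open>B\<close> being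
  the variables attached to nodes of \<open>I\<^sub>X\<close>, \<open>I\<^sub>Y\<close> below \<open>v\<close>. Both projections can be pulled out of
  a product when the other factors are nonnegative and do not mention the projected variable; this
  applies to the children of \<open>v\<close> because a clause mentioning a variable attached below one child
  lies below the same child. A node of \<open>I\<^sub>Y\<close> has no node of \<open>I\<^sub>X\<close> below it, so there \<open>A = {}\<close> and no
  exchange of the two kinds of projection is ever needed.
\<close>

section \<open>Algebra of pseudo-Boolean functions\<close>

text \<open>
  Locality fixes the values at junk assignments; this makes the laws below equations between
  values of type \<open>pb\<close> rather than mere agreement on assignments of the scope.
\<close>

definition nonneg_local :: "'v pb \<Rightarrow> bool" where
  "nonneg_local f \<longleftrightarrow>
    (\<forall>\<tau>. pb_eval f (\<tau> |` pb_scope f) = pb_eval f \<tau> \<and> 0 \<le> pb_eval f \<tau>)"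

lemma nonneg_local_restrict:
  "nonneg_local f \<Longrightarrow> pb_eval f (\<tau> |` pb_scope f) = pb_eval f \<tau>"
  by (simp add: nonneg_local_def)

lemma nonneg_local_cong:
  assumes "nonneg_local f" "\<sigma> |` pb_scope f = \<tau> |` pb_scope f"
  shows "pb_eval f \<sigma> = pb_eval f \<tau>"
  using assms nonneg_local_restrict by metis

lemma nonneg_local_nonneg: "nonneg_local f \<Longrightarrow> 0 \<le> pb_eval f \<tau>"
  by (simp add: nonneg_local_def)

section \<open>Products of local functions\<close>

lemma pb_scope_join [simp]: "pb_scope (pb_join f g) = pb_scope f \<union> pb_scope g"
  by (simp add: pb_join_def)

lemma pb_eval_join:
  assumes "nonneg_local f" "nonneg_local g"
  shows "pb_eval (pb_join f g) \<tau> = pb_eval f \<tau> * pb_eval g \<tau>"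
  using assms by (simp add: pb_join_def nonneg_local_restrict)

lemma nonneg_local_one: "nonneg_local pb_one"
  by (simp add: nonneg_local_def pb_one_def)

lemma nonneg_local_join:
  assumes "nonneg_local f" "nonneg_local g" shows "nonneg_local (pb_join f g)"
  using assms nonneg_local_nonneg[of f] nonneg_local_nonneg[of g]
  unfolding nonneg_local_def[of "pb_join f g"] pb_scope_join pb_eval_join[OF assms]
  by (auto simp: pb_join_def Int_absorb1 nonneg_local_restrict
      intro!: arg_cong2[where f = "(*)"] nonneg_local_cong)

lemma nonneg_local_clause_pb: "nonneg_local (clause_pb c)"
  by (simp add: nonneg_local_def clause_pb_def clause_sat_restrict)

lemma nonneg_local_Join:
  "finite I \<Longrightarrow> (\<And>i. i \<in> I \<Longrightarrow> nonneg_local (F i)) \<Longrightarrow> nonneg_local (pb_Join F I)"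
  by (induction I rule: finite_induct) (auto intro: nonneg_local_one nonneg_local_join)

lemma pb_scope_Join:
  "finite I \<Longrightarrow> pb_scope (pb_Join F I) = (\<Union>i\<in>I. pb_scope (F i))"
  by (induction I rule: finite_induct) (auto simp: pb_one_def)

lemma pb_join_assoc: "pb_join (pb_join f g) h = pb_join f (pb_join g h)"
  by (simp add: pb_join_def fun_eq_iff Int_absorb1 Un_assoc)

lemma pb_join_commute: "pb_join f g = pb_join g f"
  by (simp add: pb_join_def fun_eq_iff Un_commute mult.commute)

text \<open>\<open>pb_join\<close> evaluates \<open>f\<close> only at restricted assignments, so
  equality at junk assignments rests on the locality of \<open>f\<close>.\<close>

lemma pb_join_one: "nonneg_local f \<Longrightarrow> pb_join pb_one f = f"
  by (cases f) (simp add: pb_join_def pb_one_def fun_eq_iff nonneg_local_def)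

lemma pb_Join_single: "nonneg_local (F i) \<Longrightarrow> pb_Join F {i} = F i"
  by (simp add: pb_join_commute[of _ pb_one] pb_join_one)

text \<open>Locality of the factors over \<open>J\<close> serves the base case, where joining with
  \<open>pb_one\<close> must give back the product over \<open>J\<close>.\<close>

lemma pb_Join_Un:
  assumes "finite I" "finite J" "I \<inter> J = {}" "\<And>j. j \<in> J \<Longrightarrow> nonneg_local (F j)"
  shows "pb_Join F (I \<union> J) = pb_join (pb_Join F I) (pb_Join F J)"
  using assms
  by (induction I rule: finite_induct)
    (simp_all add: pb_join_assoc pb_join_one nonneg_local_Join)

text \<open>Used to split the product of the clauses below a node into one product per
  child.\<close>

lemma pb_Join_UN:
  assumes "finite I" "\<And>i. i \<in> I \<Longrightarrow> finite (L i)" "disjoint_family_on L I"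
    "\<And>l. nonneg_local (F l)"
  shows "pb_Join F (\<Union>i\<in>I. L i) = pb_Join (\<lambda>i. pb_Join F (L i)) I"
  using assms
proof (induction I rule: finite_induct)
  case (insert i I)
  then have "L i \<inter> (\<Union>i\<in>I. L i) = {}"
    by (fastforce simp: disjoint_family_on_def)
  moreover have "disjoint_family_on L I"
    using insert.prems(2) by (rule disjoint_family_on_mono[rotated]) auto
  ultimately show ?case
    using insert by (simp add: pb_Join_Un)
qed simp

lemma pb_Join_image:
  "finite I \<Longrightarrow> inj_on h I \<Longrightarrow> pb_Join F (h ` I) = pb_Join (F \<circ> h) I"
  by (induction I rule: finite_induct) auto

text \<open>What existential and random projection have in common. \<open>V\<close> holds variables
  at which projecting keeps values nonnegative: all of them for \<open>exist_proj\<close>, but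
  \<open>Y\<close> for \<open>random_proj\<close>, where \<open>pr\<close> is known to lie between 0
  and 1.\<close>

locale pb_projection =
  fixes proj :: "'v \<Rightarrow> 'v pb \<Rightarrow> 'v pb" and V :: "'v set"
  assumes commute: "comp_fun_commute proj"
    and idem: "proj x (proj x f) = proj x f"
    and scope: "pb_scope (proj x f) = pb_scope f - {x}"
    and nonneg_local: "x \<in> V \<Longrightarrow> nonneg_local f \<Longrightarrow> nonneg_local (proj x f)"
    and join: "nonneg_local f \<Longrightarrow> nonneg_local g \<Longrightarrow> x \<in> V \<Longrightarrow> x \<notin> pb_scope f \<Longrightarrow>
      pb_join f (proj x g) = proj x (pb_join f g)"
begin

abbreviation proj_set :: "'v set \<Rightarrow> 'v pb \<Rightarrow> 'v pb" where
  "proj_set S f \<equiv> Finite_Set.fold proj f S"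

text \<open>Idempotence makes the fold indifferent to repeated variables, so sets projected at
  different nodes combine as plain unions.\<close>

lemma proj_set_insert:
  "finite S \<Longrightarrow> proj_set (insert x S) f = proj x (proj_set S f)"
proof -
  have "comp_fun_idem_on UNIV proj"
    using commute idem
    by (auto simp: comp_fun_idem_on_def comp_fun_idem_on_axioms_def comp_fun_commute_def' fun_eq_iff)
  then show "finite S \<Longrightarrow> ?thesis" by (simp add: comp_fun_idem_on.fold_insert_idem)
qed

lemma proj_set_Un:
  "finite A \<Longrightarrow> finite B \<Longrightarrow> proj_set (A \<union> B) f = proj_set A (proj_set B f)"
  by (induction A rule: finite_induct) (simp_all add: proj_set_insert)

lemma scope_proj_set: "finite S \<Longrightarrow> pb_scope (proj_set S f) = pb_scope f - S"
  by (induction S rule: finite_induct) (auto simp: proj_set_insert scope)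

lemma nonneg_local_proj_set:
  "finite S \<Longrightarrow> S \<subseteq> V \<Longrightarrow> nonneg_local f \<Longrightarrow> nonneg_local (proj_set S f)"
  by (induction S rule: finite_induct) (auto simp: proj_set_insert nonneg_local)

lemma join_proj_set:
  assumes "finite S" "S \<subseteq> V" "nonneg_local f" "nonneg_local g" "S \<inter> pb_scope f = {}"
  shows "pb_join f (proj_set S g) = proj_set S (pb_join f g)"
  using assms
  by (induction S rule: finite_induct)
    (simp_all add: proj_set_insert join nonneg_local_proj_set)

text \<open>Each projected variable occurs in one factor only, so the other factors are constant in
  it and can be drawn under the projection. Applied to the children of a node, first for the
  existential and then for the random projections.\<close>

lemma Join_proj_set:
  assumes "finite I" "\<And>i. i \<in> I \<Longrightarrow> finite (A i)" "\<And>i. i \<in> I \<Longrightarrow> A i \<subseteq> V"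
    "\<And>i. i \<in> I \<Longrightarrow> nonneg_local (F i)"
    "\<And>i j. i \<in> I \<Longrightarrow> j \<in> I \<Longrightarrow> i \<noteq> j \<Longrightarrow> A i \<inter> pb_scope (F j) = {}"
  shows "pb_Join (\<lambda>i. proj_set (A i) (F i)) I = proj_set (\<Union>i\<in>I. A i) (pb_Join F I)"
  using assms
proof (induction I rule: finite_induct)
  case (insert i I)
  let ?U = "\<Union>i\<in>I. A i" and ?J = "pb_Join F I"
  have fin: "finite (A i)" "finite ?U" and sub: "A i \<subseteq> V" "?U \<subseteq> V"
    using insert by auto
  have J: "nonneg_local (F i)" "nonneg_local ?J"
    using insert by (auto intro: nonneg_local_Join)
  have disj: "A i \<inter> pb_scope (F j) = {}" "A j \<inter> pb_scope (F i) = {}" if "j \<in> I" for j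
  proof -
    have "i \<noteq> j" using that insert.hyps(2) by blast
    then show "A i \<inter> pb_scope (F j) = {}" "A j \<inter> pb_scope (F i) = {}"
      using that insert.prems(4)[of i j] insert.prems(4)[of j i] by simp_all
  qed
  have Ui: "?U \<inter> pb_scope (F i) = {}"
    using disj(2) by blast
  have iJ: "A i \<inter> pb_scope ?J = {}"
    using disj(1) unfolding pb_scope_Join[OF insert.hyps(1)] by blast
  have "pb_Join (\<lambda>i. proj_set (A i) (F i)) (insert i I)
      = pb_join (proj_set (A i) (F i)) (proj_set ?U ?J)"
    using insert by simp
  \<comment> \<open>\<open>A i\<close> is pulled out first, past a factor that is itself a
    projection; its scope lies inside that of \<open>?J\<close>, so it still avoids
    \<open>A i\<close>.\<close>
  also have "\<dots> = proj_set (A i) (pb_join (F i) (proj_set ?U ?J))"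
  proof -
    have "A i \<inter> pb_scope (proj_set ?U ?J) = {}"
      using iJ unfolding scope_proj_set[OF fin(2)] by blast
    from join_proj_set[OF fin(1) sub(1) nonneg_local_proj_set[OF fin(2) sub(2) J(2)] J(1) this]
    show ?thesis
      unfolding pb_join_commute[of "proj_set ?U ?J" "F i"]
        pb_join_commute[of "proj_set ?U ?J" "proj_set (A i) (F i)"] .
  qed
  also have "\<dots> = proj_set (A i) (proj_set ?U (pb_join (F i) ?J))"
    using join_proj_set[OF fin(2) sub(2) J Ui] by simp
  finally show ?case
    using insert.hyps fin by (simp add: proj_set_Un)
qed simp

end

section \<open>The two projections as instances\<close>

lemma restrict_upd_cong:
  assumes "S' \<subseteq> S"
  shows "((\<tau> |` (S - {x}))(x \<mapsto> b)) |` S' = (\<tau>(x \<mapsto> b)) |` S'"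
  using assms by (auto simp: fun_eq_iff restrict_map_def)

text \<open>The update overwrites \<open>x\<close>, so removing \<open>x\<close> from the scope
  beforehand goes unnoticed. This gives locality of both projections.\<close>

lemma nonneg_local_upd_restrict:
  assumes "nonneg_local f"
  shows "pb_eval f ((\<tau> |` (pb_scope f - {x}))(x \<mapsto> b)) = pb_eval f (\<tau>(x \<mapsto> b))"
  by (rule nonneg_local_cong[OF assms restrict_upd_cong]) simp

lemma nonneg_local_upd_outside:
  assumes "nonneg_local f" "x \<notin> pb_scope f"
  shows "pb_eval f (\<tau>(x \<mapsto> b)) = pb_eval f \<tau>"
  using assms by (intro nonneg_local_cong) auto

lemma nonneg_local_exist_proj:
  "nonneg_local f \<Longrightarrow> nonneg_local (exist_proj x f)"
  unfolding nonneg_local_def[of "exist_proj x f"]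
  by (simp add: exist_proj_def nonneg_local_upd_restrict nonneg_local_nonneg le_max_iff_disj)

text \<open>The bounds on \<open>p\<close> make each value a convex combination of nonnegative
  numbers.\<close>

lemma nonneg_local_random_proj:
  "nonneg_local f \<Longrightarrow> 0 \<le> p \<Longrightarrow> p \<le> 1 \<Longrightarrow> nonneg_local (random_proj p x f)"
  unfolding nonneg_local_def[of "random_proj p x f"]
  by (simp add: random_proj_def nonneg_local_upd_restrict nonneg_local_nonneg)

interpretation exist: pb_projection exist_proj UNIV
proof (rule pb_projection.intro)
  show "comp_fun_commute exist_proj" by (rule comp_fun_commute_exist_proj)
next
  fix x :: 'v and f g :: "'v pb"
  show "exist_proj x (exist_proj x f) = exist_proj x f"
    and "pb_scope (exist_proj x f) = pb_scope f - {x}"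
    by (simp_all add: exist_proj_def)
  show "nonneg_local (exist_proj x f)" if "nonneg_local f"
    using that by (rule nonneg_local_exist_proj)
  assume f: "nonneg_local f" and g: "nonneg_local g" and x: "x \<notin> pb_scope f"
  have "pb_scope f \<union> (pb_scope g - {x}) = pb_scope f \<union> pb_scope g - {x}"
    using x by auto
  \<comment> \<open>With \<open>x\<close> outside its scope, \<open>f\<close> acts as a constant
    factor; being nonnegative, it distributes over \<open>max\<close>.\<close>
  moreover have "pb_eval (pb_join f (exist_proj x g)) \<tau>
      = pb_eval (exist_proj x (pb_join f g)) \<tau>" for \<tau>
    using f g x nonneg_local_nonneg[OF f, of \<tau>]
    by (simp add: pb_eval_join nonneg_local_exist_proj)
      (simp add: exist_proj_def pb_eval_join nonneg_local_upd_outside max_mult_distrib_left)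
  ultimately show "pb_join f (exist_proj x g) = exist_proj x (pb_join f g)"
    by (intro pb.expand) (auto simp: exist_proj_def)
qed

lemma pb_projection_random:
  fixes pr :: "'v \<Rightarrow> real"
  assumes pr: "\<And>y. y \<in> Y \<Longrightarrow> 0 \<le> pr y \<and> pr y \<le> 1"
  shows "pb_projection (\<lambda>x. random_proj (pr x) x) Y"
proof (rule pb_projection.intro)
  show "comp_fun_commute (\<lambda>x. random_proj (pr x) x)" by (rule comp_fun_commute_random_proj)
next
  fix x :: 'v and f g :: "'v pb"
  show "random_proj (pr x) x (random_proj (pr x) x f) = random_proj (pr x) x f"
    and "pb_scope (random_proj (pr x) x f) = pb_scope f - {x}"
    by (simp_all add: random_proj_def fun_eq_iff algebra_simps)
  show "nonneg_local (random_proj (pr x) x f)" if "x \<in> Y" "nonneg_local f"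
    using that pr by (simp add: nonneg_local_random_proj)
  assume f: "nonneg_local f" and g: "nonneg_local g" and x: "x \<in> Y" "x \<notin> pb_scope f"
  have "pb_scope f \<union> (pb_scope g - {x}) = pb_scope f \<union> pb_scope g - {x}"
    using x by auto
  \<comment> \<open>Here the constant factor \<open>f\<close> moves in by linearity; the bounds on
    \<open>pr x\<close> ensure that \<open>pb_eval_join\<close> applies to the projected
    \<open>g\<close>.\<close>
  moreover have "pb_eval (pb_join f (random_proj (pr x) x g)) \<tau>
      = pb_eval (random_proj (pr x) x (pb_join f g)) \<tau>" for \<tau>
    using f g x pr[of x]
    by (simp add: pb_eval_join nonneg_local_random_proj)
      (simp add: random_proj_def pb_eval_join nonneg_local_upd_outside algebra_simps)
  ultimately show "pb_join f (random_proj (pr x) x g) = random_proj (pr x) x (pb_join f g)"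
    by (intro pb.expand) (auto simp: random_proj_def)
qed

section \<open>Descendants in rooted trees\<close>

context rooted_tree
begin

lemma descendant_in_verts: "descendant v w \<Longrightarrow> v \<in> verts T \<and> w \<in> verts T"
  unfolding descendant_def apath_def by (auto elim!: awalkE)

lemma apath_awlast: "apath u p v \<Longrightarrow> awlast u p = v"
  unfolding apath_def awalk_conv by blast

lemma descendant_root:
  assumes "v \<in> verts T" shows "descendant r v"
proof -
  have "r \<rightarrow>\<^sup>* v"
    using connected assms root_in_verts sym_arcs
    by (meson connected_conv symmetric_connected_imp_strongly_connected strongly_connectedE)
  then obtain p where "apath r p v" by (auto simp: reachable_apath)
  moreover have "r \<in> set (awalk_verts r p)" using calculation
    by (auto simp: apath_def elim: hd_in_awalk_verts)
  ultimately show ?thesis by (auto simp: descendant_def)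
qed

text \<open>Root paths are unique, so the path to a node passing through \<open>v\<close> must begin
  with \<open>p\<close>. Descendance thereby becomes a prefix relation between arc lists.\<close>

lemma descendant_append_conv:
  assumes "apath r p v"
  shows "descendant v w \<longleftrightarrow> (\<exists>q. apath r (p @ q) w)"
proof
  assume "descendant v w"
  then obtain s where s: "apath r s w" "v \<in> set (awalk_verts r s)"
    by (auto simp: descendant_def)
  then have "awalk r s w" by (simp add: apath_def)
  then obtain a b where ab: "s = a @ b" "awalk r a v" "awalk v b w"
    using awalk_decomp s(2) by blast
  then have "apath r a v" using s(1) by (auto simp: apath_append_iff)
  then have "a = p" using assms apath_unique by blast
  with s ab show "\<exists>q. apath r (p @ q) w" by blast
next
  assume "\<exists>q. apath r (p @ q) w"
  then obtain q where q: "apath r (p @ q) w" by blast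
  then have "awalk_verts r (p @ q) = awalk_verts r p @ tl (awalk_verts (awlast r p) q)"
    using awalk_verts_append unfolding apath_def by blast
  with apath_last_in_verts[OF assms] have "v \<in> set (awalk_verts r (p @ q))" by simp
  with q show "descendant v w" by (auto simp: descendant_def)
qed

lemma descendant_refl: "v \<in> verts T \<Longrightarrow> descendant v v"
  using descendant_root[of v] apath_last_in_verts by (auto simp: descendant_def)

lemma descendant_trans:
  assumes "descendant u v" "descendant v w" shows "descendant u w"
proof -
  from assms obtain p where p: "apath r p u"
    using descendant_in_verts descendant_root by (metis descendant_def)
  with assms(1) obtain q where q: "apath r (p @ q) v"
    unfolding descendant_append_conv[OF p] by blast
  with assms(2) obtain s where "apath r ((p @ q) @ s) w"
    unfolding descendant_append_conv[OF q] by blast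
  then show ?thesis unfolding descendant_append_conv[OF p] by auto
qed

text \<open>The arc from \<open>v\<close> to a child and the rest of the child's root path after
  \<open>p\<close> join the same two nodes, so uniqueness of paths identifies them.\<close>

lemma children_append_conv:
  assumes "apath r p v"
  shows "w \<in> children v \<longleftrightarrow> (\<exists>e. apath r (p @ [e]) w)"
proof
  assume w: "w \<in> children v"
  then have vw: "v \<rightarrow> w" and "descendant v w" by (auto simp: children_def)
  then obtain q where q: "apath r (p @ q) w" by (auto simp: descendant_append_conv[OF assms])
  from vw obtain e where e: "e \<in> arcs T" "tail T e = v" "head T e = w" by auto
  moreover have "v \<noteq> w" using vw adj_not_same by blast
  ultimately have "apath v [e] w"
    using head_in_verts[of e] by (simp add: apath_Cons_iff apath_Nil_iff)
  moreover have "apath v q w"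
    using q unfolding apath_append_iff apath_awlast[OF assms] by blast
  ultimately have "q = [e]" using apath_unique by blast
  with q show "\<exists>e. apath r (p @ [e]) w" by blast
next
  assume "\<exists>e. apath r (p @ [e]) w"
  then obtain e where e: "apath r (p @ [e]) w" by blast
  then have "apath v [e] w"
    unfolding apath_append_iff apath_awlast[OF assms] by blast
  then have "v \<rightarrow> w"
    using in_arcs_imp_in_arcs_ends[of e] by (simp add: apath_Cons_iff apath_Nil_iff)
  with e show "w \<in> children v"
    by (auto simp: children_def descendant_append_conv[OF assms])
qed

lemma finite_children: "finite (children v)"
  by (rule finite_subset[of _ "verts T"]) (auto simp: children_def dest: descendant_in_verts)

lemma root_path:
  assumes "v \<in> verts T" obtains p where "apath r p v"
  using descendant_root[OF assms] by (auto simp: descendant_def)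

text \<open>The root path to a descendant either stops at \<open>v\<close> or continues with an arc,
  and the first such arc leads to a child.\<close>

lemma descendant_cases:
  assumes "v \<in> verts T"
  shows "{u. descendant v u} = insert v (\<Union>w\<in>children v. {u. descendant w u})"
proof (intro equalityI subsetI)
  fix u assume "u \<in> {u. descendant v u}"
  moreover obtain p where p: "apath r p v" using root_path assms by blast
  ultimately obtain q where q: "apath r (p @ q) u"
    unfolding descendant_append_conv[OF p] by blast
  show "u \<in> insert v (\<Union>w\<in>children v. {u. descendant w u})"
  proof (cases q)
    case Nil
    with q have "apath r p u" by simp
    then have "u = v" using apath_awlast[OF p] apath_awlast[of r p u] by simp
    then show ?thesis by simp
  next
    case (Cons e s)
    with q have pes: "apath r ((p @ [e]) @ s) u" by simp
    then have e: "apath r (p @ [e]) (awlast r (p @ [e]))"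
      unfolding apath_append_iff by blast
    with p have "awlast r (p @ [e]) \<in> children v" using children_append_conv by blast
    moreover have "descendant (awlast r (p @ [e])) u"
      using pes descendant_append_conv[OF e] by blast
    ultimately show ?thesis by blast
  qed
qed (use assms in \<open>auto simp: children_def intro: descendant_refl descendant_trans\<close>)

text \<open>The arc that follows \<open>p\<close> on the unique root path to \<open>u\<close>
  determines the child.\<close>

lemma children_descendants_disjoint:
  assumes "w \<in> children v" "w' \<in> children v" "descendant w u" "descendant w' u"
  shows "w = w'"
proof -
  obtain p where p: "apath r p v"
  proof -
    have "v \<in> verts T"
      using assms(1) descendant_in_verts unfolding children_def by blast
    then show thesis using root_path that by blast
  qed
  from assms(1,2) obtain e e' where e: "apath r (p @ [e]) w" and e': "apath r (p @ [e']) w'"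
    unfolding children_append_conv[OF p] by blast
  from assms(3,4) obtain q q' where q: "apath r ((p @ [e]) @ q) u" "apath r ((p @ [e']) @ q') u"
    unfolding descendant_append_conv[OF e] descendant_append_conv[OF e'] by blast
  then have "(p @ [e]) @ q = (p @ [e']) @ q'" by (rule apath_unique)
  then have "e = e'" by simp
  with apath_awlast[OF e] apath_awlast[OF e'] show ?thesis by (simp only:)
qed

text \<open>The only arc leaving \<open>v\<close> is the reverse of the last arc \<open>f\<close> of
  its root path. A child would thus be the parent, reached by two different root paths: one stopping
  before \<open>f\<close>, the other going along \<open>f\<close> and back.\<close>

lemma children_leaf:
  assumes "v \<in> leaves" shows "children v = {}"
proof (rule ccontr)
  assume "children v \<noteq> {}"
  then obtain w where w: "w \<in> children v" by blast
  have v: "v \<in> verts T" "v \<noteq> r" "out_degree T v = 1" using assms by (auto simp: leaves_def)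
  obtain p where p: "apath r p v" using root_path v by blast
  with w obtain e where e: "apath r (p @ [e]) w" by (auto simp: children_append_conv[OF p])
  have "p \<noteq> []" using p v by (auto simp: apath_def awalk_Nil_iff)
  then obtain q f where qf: "p = q @ [f]" by (metis rev_exhaust)
  have f: "f \<in> arcs T" "head T f = v" "tail T f = awlast r q"
    using p unfolding qf apath_def awalk_append_iff awalk_Cons_iff awalk_Nil_iff by simp_all
  have ee: "e \<in> arcs T" "tail T e = v" "head T e = w"
    using e apath_awlast[OF p] unfolding apath_def awalk_append_iff awalk_Cons_iff awalk_Nil_iff
    by simp_all
  obtain g where g: "g \<in> arcs T" "tail T g = v" "head T g = tail T f"
    using sym_arcs f unfolding symmetric_conv by metis
  have "e \<in> out_arcs T v" "g \<in> out_arcs T v" using ee g by auto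
  with v(3) have "e = g"
    unfolding out_degree_def by (metis card_1_singletonE singletonD)
  then have "w = awlast r q" using ee g f by simp
  moreover have "apath r (q @ [f, e]) w" using e qf by simp
  moreover have "q @ [f, e] \<noteq> q" by simp
  moreover have "apath r q (awlast r q)"
    using calculation(2) unfolding apath_append_iff by blast
  ultimately show False using apath_unique[of r "q @ [f, e]" w q] by simp
qed

end

section \<open>Valuations of graded project-join trees\<close>

context graded_project_join_tree
begin

text \<open>The parameter \<open>I\<close> lets one notion serve both grades:
  \<open>I\<^sub>X\<close> yields the existentially projected variables, \<open>I\<^sub>Y\<close>
  the randomly projected ones.\<close>

definition vars_below :: "'n set \<Rightarrow> 'n \<Rightarrow> 'v set" where
  "vars_below I v = (\<Union>u\<in>{u\<in>I. descendant v u}. \<pi> u)"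

definition leaves_below :: "'n \<Rightarrow> 'n set" where
  "leaves_below v = {u \<in> leaves. descendant v u}"

lemma leaf_not_internal: "v \<in> leaves \<Longrightarrow> v \<notin> I\<^sub>X \<and> v \<notin> I\<^sub>Y"
  using grades_Un by (auto simp: internal_def)

lemma finite_leaves_below: "finite (leaves_below v)"
  by (rule finite_subset[of _ "verts T"]) (auto simp: leaves_below_def leaves_def)

lemma vars_below_rec:
  assumes "v \<in> verts T"
  shows "vars_below I v = (if v \<in> I then \<pi> v else {}) \<union> (\<Union>w\<in>children v. vars_below I w)"
proof -
  have "descendant v u \<longleftrightarrow> u = v \<or> (\<exists>w\<in>children v. descendant w u)" for u
    using descendant_cases[OF assms] by blast
  then show ?thesis by (auto simp: vars_below_def)
qed

lemma leaves_below_rec: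
  assumes "v \<in> verts T"
  shows "leaves_below v = (if v \<in> leaves then {v} else {}) \<union> (\<Union>w\<in>children v. leaves_below w)"
proof -
  have "descendant v u \<longleftrightarrow> u = v \<or> (\<exists>w\<in>children v. descendant w u)" for u
    using descendant_cases[OF assms] by blast
  then show ?thesis by (auto simp: leaves_below_def)
qed

text \<open>
  A clause mentioning a variable that is projected below \<open>w\<close> sits at a leaf below \<open>w\<close>, and
  subtrees of siblings are disjoint.
\<close>

lemma vars_below_disjoint:
  assumes "I \<subseteq> internal" "w \<in> children v" "w' \<in> children v" "w \<noteq> w'"
  shows "vars_below I w \<inter> (\<Union>l\<in>leaves_below w'. clause_vars (\<gamma> l)) = {}"
proof (rule ccontr)
  assume "\<not> ?thesis"
  then obtain x u l where u: "u \<in> I" "descendant w u" "x \<in> \<pi> u"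
    and l: "l \<in> leaves" "descendant w' l" "x \<in> clause_vars (\<gamma> l)"
    by (auto simp: vars_below_def leaves_below_def)
  have "\<gamma> l \<in> \<phi>" "the_inv_into leaves \<gamma> (\<gamma> l) = l"
    using gamma_bij l(1) by (auto simp: bij_betw_def the_inv_into_f_f)
  then have "descendant u l"
    using pi_descendant[of u x "\<gamma> l"] u l assms(1) by auto
  then have "descendant w l" using u descendant_trans by blast
  then show False using children_descendants_disjoint assms l by blast
qed

text \<open>The induction measure is the one behind the termination of \<open>valuation\<close>; it
  drops from a node to its children. The bounds on \<open>pr\<close> keep all factors
  nonnegative.\<close>

lemma valuation_eq:
  assumes pr: "\<And>y. y \<in> Y \<Longrightarrow> 0 \<le> pr y \<and> pr y \<le> 1" and fin: "finite (cnf_vars \<phi>)"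
    and "v \<in> verts T"
  shows "valuation pr v = exist_proj_set (vars_below I\<^sub>X v) (random_proj_set pr (vars_below I\<^sub>Y v)
      (pb_Join (clause_pb \<circ> \<gamma>) (leaves_below v)))"
  using \<open>v \<in> verts T\<close>
proof (induction "card (verts T) - depth v" arbitrary: v rule: less_induct)
  case less
  interpret random: pb_projection "\<lambda>x. random_proj (pr x) x" Y
    using pr by (rule pb_projection_random)
  \<comment> \<open>The two layers of projections are drawn out of the product over the children one
    after the other: the existential ones from the factors \<open>R w\<close>, then the random ones
    from the factors \<open>F w\<close>.\<close>
  define F where "F w = pb_Join (clause_pb \<circ> \<gamma>) (leaves_below w)" for w
  define R where "R w = random_proj_set pr (vars_below I\<^sub>Y w) (F w)" for w
  have internal: "I\<^sub>X \<subseteq> internal" "I\<^sub>Y \<subseteq> internal" using grades_Un by auto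
  have fin_pi: "finite (\<pi> u)" if "u \<in> internal" for u
    using fin that pi_Union by (auto intro: finite_subset)
  have finb: "finite (vars_below I w)" if "I \<subseteq> internal" for I w
    using that pi_Union by (intro finite_subset[OF _ fin]) (auto simp: vars_below_def)
  have sub: "vars_below I\<^sub>Y w \<subseteq> Y" for w using pi_Y by (auto simp: vars_below_def)
  have F: "nonneg_local (F w)" for w
    unfolding F_def by (intro nonneg_local_Join finite_leaves_below) (simp add: nonneg_local_clause_pb)
  have scopeF: "pb_scope (F w) = (\<Union>l\<in>leaves_below w. clause_vars (\<gamma> l))" for w
    unfolding F_def by (simp add: pb_scope_Join finite_leaves_below clause_pb_def)
  have R: "nonneg_local (R w)" for w
    unfolding R_def random_proj_set_def
    by (intro random.nonneg_local_proj_set finb internal sub F)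
  \<comment> \<open>Projection only shrinks scopes, so variables foreign to the clauses below
    \<open>w\<close> are foreign to \<open>R w\<close> as well.\<close>
  have scopeR: "pb_scope (R w) \<subseteq> pb_scope (F w)" for w
    unfolding R_def random_proj_set_def
    using random.scope_proj_set[OF finb[OF internal(2)]] by auto
  show ?case
  proof (cases "v \<in> leaves")
    case True
    then have "leaves_below v = {v}" "vars_below I\<^sub>X v = {}" "vars_below I\<^sub>Y v = {}"
      by (simp_all add: leaves_below_rec[OF less.prems] vars_below_rec[OF less.prems]
          children_leaf[OF True] leaf_not_internal[OF True])
    moreover have "pb_Join (clause_pb \<circ> \<gamma>) {v} = clause_pb (\<gamma> v)"
      using pb_Join_single[of "clause_pb \<circ> \<gamma>" v] by (simp add: nonneg_local_clause_pb)
    ultimately show ?thesis using True by (simp add: valuation.simps[of pr v])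
  next
    case False
    let ?C = "children v"
    let ?UX = "\<Union>w\<in>?C. vars_below I\<^sub>X w" and ?UY = "\<Union>w\<in>?C. vars_below I\<^sub>Y w"
    have fU: "finite ?UX" "finite ?UY" using finb internal finite_children by auto
    have "disjoint_family_on leaves_below ?C"
      using children_descendants_disjoint[of _ v]
      by (auto simp: disjoint_family_on_def leaves_below_def)
    then have "pb_Join (clause_pb \<circ> \<gamma>) (\<Union>w\<in>?C. leaves_below w)
        = pb_Join (\<lambda>w. pb_Join (clause_pb \<circ> \<gamma>) (leaves_below w)) ?C"
      by (intro pb_Join_UN finite_children finite_leaves_below) (simp_all add: nonneg_local_clause_pb)
    \<comment> \<open>As \<open>v\<close> is not a leaf, every leaf below it lies below one of its
      children.\<close>
    then have "pb_Join F ?C = F v"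
      using False unfolding F_def[abs_def] leaves_below_rec[OF less.prems] by simp
    moreover have "pb_Join R ?C = random_proj_set pr ?UY (pb_Join F ?C)"
      unfolding R_def random_proj_set_def
      by (intro random.Join_proj_set finite_children finb internal sub F)
        (unfold scopeF, rule vars_below_disjoint[OF internal(2)])
    moreover have "pb_Join (valuation pr) ?C
        = pb_Join (\<lambda>w. exist_proj_set (vars_below I\<^sub>X w) (R w)) ?C"
    proof (rule pb_Join_cong[OF refl])
      fix w assume w: "w \<in> ?C"
      then have "w \<in> verts T" by (auto simp: children_def dest: descendant_in_verts)
      then show "valuation pr w = exist_proj_set (vars_below I\<^sub>X w) (R w)"
        unfolding R_def F_def by (rule less.hyps[OF card_depth_less[OF w]])
    qed
    moreover have "pb_Join (\<lambda>w. exist_proj_set (vars_below I\<^sub>X w) (R w)) ?C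
        = exist_proj_set ?UX (pb_Join R ?C)"
      unfolding exist_proj_set_def
    proof (rule exist.Join_proj_set)
      fix w w' assume w: "w \<in> ?C" "w' \<in> ?C" "w \<noteq> w'"
      show "vars_below I\<^sub>X w \<inter> pb_scope (R w') = {}"
        using vars_below_disjoint[OF internal(1) w] scopeR[of w'] unfolding scopeF by blast
    qed (rule finite_children finb[OF internal(1)] R subset_UNIV)+
    ultimately have step: "pb_Join (valuation pr) ?C
        = exist_proj_set ?UX (random_proj_set pr ?UY (F v))" by simp
    have "v \<in> I\<^sub>X \<union> I\<^sub>Y" using False less.prems grades_Un by (simp add: internal_def)
    then show ?thesis
    proof
      assume v: "v \<in> I\<^sub>X"
      then have vY: "v \<notin> I\<^sub>Y" and fpi: "finite (\<pi> v)"
        using grades_Int fin_pi internal by auto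
      have "valuation pr v = exist_proj_set (\<pi> v) (pb_Join (valuation pr) ?C)"
        using v False by (simp add: valuation.simps[of pr v])
      \<comment> \<open>The existential layer is outermost already, so \<open>\<pi> v\<close> is
        absorbed into it.\<close>
      also have "\<dots> = exist_proj_set (\<pi> v \<union> ?UX) (random_proj_set pr ?UY (F v))"
        unfolding step exist_proj_set_def exist.proj_set_Un[OF fpi fU(1)] ..
      finally show ?thesis
        using v vY unfolding F_def vars_below_rec[OF less.prems] by simp
    next
      assume v: "v \<in> I\<^sub>Y"
      then have vX: "v \<notin> I\<^sub>X" and fpi: "finite (\<pi> v)"
        using grades_Int fin_pi internal by auto
      \<comment> \<open>An empty existential layer exposes the random layer, which can then absorb
        \<open>\<pi> v\<close>.\<close>
      have "vars_below I\<^sub>X v = {}"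
        using grades_descendant[OF v] by (auto simp: vars_below_def)
      then have UX: "?UX = {}" using vX unfolding vars_below_rec[OF less.prems] by simp
      have "valuation pr v = random_proj_set pr (\<pi> v) (pb_Join (valuation pr) ?C)"
        using v vX False by (simp add: valuation.simps[of pr v])
      also have "\<dots> = random_proj_set pr (\<pi> v \<union> ?UY) (F v)"
        unfolding step UX exist_proj_set_empty random_proj_set_def
          random.proj_set_Un[OF fpi fU(2)] ..
      finally show ?thesis
        using v vX UX unfolding F_def vars_below_rec[OF less.prems] by simp
    qed
  qed
qed

section \<open>Specialisation to the root\<close>

lemma vars_below_root:
  assumes "I \<subseteq> internal" shows "vars_below I r = (\<Union>u\<in>I. \<pi> u)"
  using assms descendant_root by (auto simp: vars_below_def internal_def)

lemma leaves_below_root: "leaves_below r = leaves"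
  using descendant_root by (auto simp: leaves_below_def leaves_def)

end

theorem theorem1:
  fixes T :: "('n, 'e) pre_digraph" and r :: 'n
    and \<gamma> :: "'n \<Rightarrow> 'v clause" and \<pi> :: "'n \<Rightarrow> 'v set" and \<phi> :: "'v cnf"
    and X Y :: "'v set" and I\<^sub>X I\<^sub>Y :: "'n set" and pr :: "'v \<Rightarrow> real"
  assumes "is_cnf \<phi>"
    and "X \<union> Y = cnf_vars \<phi>" and "X \<inter> Y = {}"
    and "graded_project_join_tree T r \<gamma> \<pi> \<phi> X Y I\<^sub>X I\<^sub>Y"
    and "\<And>y. y \<in> Y \<Longrightarrow> 0 \<le> pr y \<and> pr y \<le> 1"
  shows "pb_eval (graded_project_join_tree.valuation T r \<gamma> \<pi> I\<^sub>X I\<^sub>Y pr r) Map.empty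
       = pb_eval (exist_proj_set X (random_proj_set pr Y (cnf_pb \<phi>))) Map.empty"
proof -
  interpret graded_project_join_tree T r \<gamma> \<pi> \<phi> X Y I\<^sub>X I\<^sub>Y by (rule assms(4))
  have "finite (cnf_vars \<phi>)"
    using assms(1) by (auto simp: is_cnf_def cnf_vars_def clause_vars_def)
  note val = valuation_eq[OF assms(5) this root_in_verts]
  \<comment> \<open>The variables of each grade lie in the matching block; as the blocks are
    disjoint and the unions agree, both inclusions are equalities.\<close>
  have "(\<Union>u\<in>I\<^sub>X. \<pi> u) \<union> (\<Union>u\<in>I\<^sub>Y. \<pi> u) = X \<union> Y"
    using pi_Union grades_Un assms(2) by (simp flip: UN_Un)
  moreover have "(\<Union>u\<in>I\<^sub>X. \<pi> u) \<subseteq> X" "(\<Union>u\<in>I\<^sub>Y. \<pi> u) \<subseteq> Y" using pi_X pi_Y by auto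
  ultimately have "(\<Union>u\<in>I\<^sub>X. \<pi> u) = X" "(\<Union>u\<in>I\<^sub>Y. \<pi> u) = Y" using assms(3) by blast+
  then have "vars_below I\<^sub>X r = X" "vars_below I\<^sub>Y r = Y"
    using grades_Un vars_below_root[of I\<^sub>X] vars_below_root[of I\<^sub>Y] by blast+
  \<comment> \<open>Reindexing along the bijection \<open>\<gamma>\<close> turns the product over
    leaves into the product over clauses.\<close>
  moreover have "pb_Join (clause_pb \<circ> \<gamma>) leaves = cnf_pb \<phi>"
    using pb_Join_image[of leaves \<gamma> clause_pb] gamma_bij finite_leaves_below[of r]
    by (simp add: cnf_pb_def bij_betw_def leaves_below_root)
  ultimately show ?thesis using val by (simp add: leaves_below_root)
qed

end
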